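(* Let $\Omega=\{1,\dots,K\}$ and suppose $g:2^\Omega\to\mathbb{R}_+$ satisfies the submodular property $g(S)+g(T)\ge g(S\cap T)+g(S\cup T)$ for all $S,T\subseteq\Omega$. Let $\mathcal{P}(g)=\{\mathbf{r}\in\mathbb{R}_+^K:\ \sum_{i\in S}r_i\le g(S)\ \ \forall S\subseteq\Omega\}$. Then the max-min fair point $\mathbf{r}^{MM}$ in $\mathcal{P}(g)$ lies on the dominant face $\{\mathbf{r}\in\mathcal{P}(g):\ \sum_{i\in\Omega}r_i=g(\Omega)\}$, and $\mathbf{r}^{MM}$ is majorized by every point on the dominant face, i.e. $\mathbf{r}^{MM}\preceq\mathbf{r}$ for every $\mathbf{r}$ on the dominant face.
   Context: $\mathbb{R}_+$ denotes the nonnegative reals. A point $\mathbf{r}^{MM}\in\mathcal{R}$ of a set $\mathcal{R}\subseteq\mathbb{R}_+^K$ is max-min fair in $\mathcal{R}$ if for every $\mathbf{r}\in\mathcal{R}$ and every $i$ with $r_i>r_i^{MM}$ there is $j\in\Omega$ with $r_j<r_j^{MM}\le r_i^{MM}$. For $\mathbf{x}\in\mathbb{R}_+^K$ let $x_{[1]}\le\dots\le x_{[K]}$ be its components in nondecreasing order. $\mathbf{x}$ is majorized by $\mathbf{y}$, written $\mathbf{x}\preceq\mathbf{y}$, if $\sum_{i=1}^k x_{[i]}\ge\sum_{i=1}^k y_{[i]}$ for $k=1,\dots,K-1$ and $\sum_{i=1}^K x_{[i]}=\sum_{i=1}^K y_{[i]}$. *)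

theory Defs
  imports "HOL-Analysis.Analysis" "HOL-Library.Multiset"
begin

(* The index set Omega = {1, ..., K} is the universe of the finite type 'n, so K = CARD('n) >= 1. *)

definition submodular :: "('n set \<Rightarrow> real) \<Rightarrow> bool" where
  "submodular g \<longleftrightarrow> (\<forall>S T. g S + g T \<ge> g (S \<inter> T) + g (S \<union> T))"

(* Neither monotonicity nor g {} = 0 is required. *)
definition polymatroid :: "('n::finite set \<Rightarrow> real) \<Rightarrow> (real ^ 'n) set" where
  "polymatroid g = {r. (\<forall>i. 0 \<le> r $ i) \<and> (\<forall>S. (\<Sum>i\<in>S. r $ i) \<le> g S)}"

definition dominant_face :: "('n::finite set \<Rightarrow> real) \<Rightarrow> (real ^ 'n) set" where
  "dominant_face g = {r \<in> polymatroid g. (\<Sum>i\<in>UNIV. r $ i) = g UNIV}"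

definition max_min_fair :: "(real ^ 'n::finite) set \<Rightarrow> real ^ 'n \<Rightarrow> bool" where
  "max_min_fair R m \<longleftrightarrow> m \<in> R \<and>
     (\<forall>r\<in>R. \<forall>i. r $ i > m $ i \<longrightarrow> (\<exists>j. r $ j < m $ j \<and> m $ j \<le> m $ i))"

(* The k-th smallest component of x, counted with multiplicity; meaningful for 1 <= k <= K. *)
definition order_stat :: "real ^ 'n::finite \<Rightarrow> nat \<Rightarrow> real" where
  "order_stat x k = sorted_list_of_multiset (image_mset (\<lambda>i. x $ i) (mset_set UNIV)) ! (k - 1)"

(* Components are sorted increasingly, so x is majorized by y when the partial sums of x
   are the larger ones. *)
definition majorized_by :: "real ^ 'n::finite \<Rightarrow> real ^ 'n \<Rightarrow> bool" (infix "\<preceq>\<^sub>m" 50) where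
  "x \<preceq>\<^sub>m y \<longleftrightarrow>
     (\<forall>k\<in>{1..CARD('n) - 1}. (\<Sum>i=1..k. order_stat x i) \<ge> (\<Sum>i=1..k. order_stat y i)) \<and>
     (\<Sum>i=1..CARD('n). order_stat x i) = (\<Sum>i=1..CARD('n). order_stat y i)"

end

theory Submission
  imports Defs
begin

text \<open>
  Call \<open>S\<close> tight for \<open>m\<close> if \<open>m(S) = g(S)\<close>. By submodularity tight sets are closed under union and
  intersection, and an exchange argument on the smallest tight set around \<open>i\<close> shows that a max-min
  fair point \<open>m\<close> has, for each \<open>i\<close>, a tight set around \<open>i\<close> on which \<open>m\<close> is at most \<open>m\<^sub>i\<close>; conversely
  this property implies fairness. Existence follows because the point of the polymatroid closest to
  \<open>(C, \<dots>, C)\<close>, for large \<open>C\<close>, admits no improving exchange either. All nonempty lower level sets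
  of \<open>m\<close> are then tight, so \<open>\<Sum>(s - r\<^sub>i)\<^sup>+ \<ge> \<Sum>(s - m\<^sub>i)\<^sup>+\<close> for all \<open>s\<close> and all \<open>r\<close> in the
  polymatroid; this is dual to majorization, since the sum of the \<open>k\<close> smallest components of \<open>x\<close> is
  the maximum over \<open>s\<close> of \<open>k s - \<Sum>(s - x\<^sub>i)\<^sup>+\<close>.
\<close>

section \<open>Lattice of tight sets\<close>

definition tight :: "('n::finite set \<Rightarrow> real) \<Rightarrow> real ^ 'n \<Rightarrow> 'n set \<Rightarrow> bool" where
  "tight g m S \<longleftrightarrow> (\<Sum>i\<in>S. m $ i) = g S"

text \<open>Such an \<open>S\<close> is a bottleneck: raising \<open>i\<close> forces a decrease
  inside \<open>S\<close>, where no component exceeds \<open>m $ i\<close>.\<close>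

definition tightly_topped :: "('n::finite set \<Rightarrow> real) \<Rightarrow> real ^ 'n \<Rightarrow> 'n \<Rightarrow> bool" where
  "tightly_topped g m i \<longleftrightarrow> (\<exists>S. tight g m S \<and> i \<in> S \<and> (\<forall>j\<in>S. m $ j \<le> m $ i))"

lemma polymatroidD:
  assumes "m \<in> polymatroid g"
  shows "0 \<le> m $ i" and "(\<Sum>i\<in>S. m $ i) \<le> g S"
  using assms by (auto simp: polymatroid_def)

text \<open>The slacks of union and intersection are nonnegative, and submodularity bounds their sum
  by zero.\<close>

lemma tight_Un_Int:
  assumes "submodular g" "m \<in> polymatroid g" "tight g m S" "tight g m T"
  shows "tight g m (S \<union> T)" and "tight g m (S \<inter> T)"
proof -
  have "(\<Sum>i\<in>S \<union> T. m $ i) + (\<Sum>i\<in>S \<inter> T. m $ i) = (\<Sum>i\<in>S. m $ i) + (\<Sum>i\<in>T. m $ i)"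
    by (rule sum.union_inter) auto
  moreover have "g (S \<inter> T) + g (S \<union> T) \<le> g S + g T"
    using assms(1) by (auto simp: submodular_def)
  ultimately show "tight g m (S \<union> T)" "tight g m (S \<inter> T)"
    using polymatroidD(2)[OF assms(2), of "S \<union> T"] polymatroidD(2)[OF assms(2), of "S \<inter> T"] assms(3,4)
    unfolding tight_def by linarith+
qed

lemma tight_Union:
  assumes "submodular g" "m \<in> polymatroid g" "finite F" "F \<noteq> {}" "\<And>S. S \<in> F \<Longrightarrow> tight g m S"
  shows "tight g m (\<Union>F)"
  using assms(3-5)
proof (induction F rule: finite_ne_induct)
  case (insert S F)
  then show ?case using tight_Un_Int(1)[OF assms(1,2), of S "\<Union>F"] by simp
qed simp

lemma tight_Inter:
  assumes "submodular g" "m \<in> polymatroid g" "finite F" "F \<noteq> {}" "\<And>S. S \<in> F \<Longrightarrow> tight g m S"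
  shows "tight g m (\<Inter>F)"
  using assms(3-5)
proof (induction F rule: finite_ne_induct)
  case (insert S F)
  then show ?case using tight_Un_Int(2)[OF assms(1,2), of S "\<Inter>F"] by simp
qed simp

section \<open>Feasible directions and exchanges\<close>

lemma uniform_slack:
  assumes "m \<in> polymatroid g"
  obtains d where "d > 0" "\<And>S. \<not> tight g m S \<Longrightarrow> (\<Sum>i\<in>S. m $ i) + d \<le> g S"
proof
  \<comment> \<open>The extra \<open>1\<close> keeps \<open>D\<close> nonempty if every set is
    tight.\<close>
  define D where "D = insert 1 ((\<lambda>S. g S - (\<Sum>i\<in>S. m $ i)) ` {S. \<not> tight g m S})"
  have fin: "finite D" "D \<noteq> {}" by (auto simp: D_def)
  have "x > 0" if "x \<in> D" for x
    using that polymatroidD(2)[OF assms] by (auto simp: D_def tight_def less_le)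
  then show "Min D > 0" using fin by simp
  show "(\<Sum>i\<in>S. m $ i) + Min D \<le> g S" if "\<not> tight g m S" for S
  proof -
    have "g S - (\<Sum>i\<in>S. m $ i) \<in> D" using that by (auto simp: D_def)
    then show ?thesis using Min_le[OF fin(1)] by fastforce
  qed
qed

text \<open>Tight sets do not grow along \<open>v\<close> and the others grow at rate at most 1, so
  their uniform slack absorbs short steps.\<close>

lemma feasible_direction:
  assumes m: "m \<in> polymatroid g"
    and le1: "\<And>S. (\<Sum>k\<in>S. v $ k) \<le> 1"
    and tight_le: "\<And>S. tight g m S \<Longrightarrow> (\<Sum>k\<in>S. v $ k) \<le> 0"
    and c: "0 < c" "\<And>e k. 0 < e \<Longrightarrow> e \<le> c \<Longrightarrow> 0 \<le> (m + e *\<^sub>R v) $ k"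
  obtains d where "0 < d" "\<And>e. 0 < e \<Longrightarrow> e \<le> d \<Longrightarrow> m + e *\<^sub>R v \<in> polymatroid g"
proof -
  obtain b where b: "b > 0" "\<And>S. \<not> tight g m S \<Longrightarrow> (\<Sum>i\<in>S. m $ i) + b \<le> g S"
    using uniform_slack[OF m] by metis
  have "m + e *\<^sub>R v \<in> polymatroid g" if e: "0 < e" "e \<le> min b c" for e
  proof -
    have "(\<Sum>k\<in>S. (m + e *\<^sub>R v) $ k) \<le> g S" for S
    proof -
      have eq: "(\<Sum>k\<in>S. (m + e *\<^sub>R v) $ k) = (\<Sum>k\<in>S. m $ k) + e * (\<Sum>k\<in>S. v $ k)"
        by (simp add: sum.distrib sum_distrib_left)
      show ?thesis
      proof (cases "tight g m S")
        case True
        then have "e * (\<Sum>k\<in>S. v $ k) \<le> 0"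
          using tight_le e by (simp add: mult_nonneg_nonpos)
        then show ?thesis unfolding eq using True by (simp add: tight_def)
      next
        case False
        have "e * (\<Sum>k\<in>S. v $ k) \<le> e"
          using le1[of S] e by (simp add: mult_left_le)
        moreover have "e \<le> b" using e by simp
        ultimately show ?thesis unfolding eq using b(2)[OF False] by linarith
      qed
    qed
    then show ?thesis using c(2)[of e] e unfolding polymatroid_def by auto
  qed
  then show ?thesis using that[of "min b c"] b c by auto
qed

lemma sum_axis: "(\<Sum>k\<in>S. axis i (1::real) $ k) = of_bool (i \<in> S)" for i :: "'n::finite"
  by (simp add: axis_def)

lemma improving_exchange:
  assumes "submodular g" and m: "m \<in> polymatroid g" and not: "\<not> tightly_topped g m i"
  obtains v d where "0 < d" "\<And>e. 0 < e \<Longrightarrow> e \<le> d \<Longrightarrow> m + e *\<^sub>R v \<in> polymatroid g"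
    "v = axis i 1 \<or> (\<exists>j. m $ i < m $ j \<and> v = axis i 1 - axis j 1)"
proof (cases "\<exists>S. tight g m S \<and> i \<in> S")
  case False
  obtain d where "0 < d" "\<And>e. 0 < e \<Longrightarrow> e \<le> d \<Longrightarrow> m + e *\<^sub>R axis i 1 \<in> polymatroid g"
  proof (rule feasible_direction[OF m, of "axis i 1" 1])
    show "0 \<le> (m + e *\<^sub>R axis i 1) $ k" if "0 < e" for e k
      using polymatroidD(1)[OF m, of k] that by (simp add: axis_def)
  qed (use False in \<open>auto simp: sum_axis\<close>)
  then show ?thesis using that by blast
next
  case True
  define S where "S = \<Inter>{S. tight g m S \<and> i \<in> S}"
  have "tight g m S" unfolding S_def
    by (rule tight_Inter[OF assms(1,2)]) (use True in auto)
  moreover have "i \<in> S" by (simp add: S_def)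
  ultimately obtain j where j: "j \<in> S" "m $ i < m $ j"
    using not unfolding tightly_topped_def by (meson not_le)
  obtain d where "0 < d"
    "\<And>e. 0 < e \<Longrightarrow> e \<le> d \<Longrightarrow> m + e *\<^sub>R (axis i 1 - axis j 1) \<in> polymatroid g"
  proof (rule feasible_direction[OF m, of "axis i 1 - axis j 1" "m $ j - m $ i"])
    \<comment> \<open>A tight set around \<open>i\<close> contains \<open>S\<close>, hence also
      \<open>j\<close>, so gain and loss cancel on it.\<close>
    show "(\<Sum>k\<in>T. (axis i 1 - axis j 1) $ k) \<le> (0::real)" if "tight g m T" for T
      using that j(1) by (auto simp: sum_subtractf sum_axis S_def)
    \<comment> \<open>With this step bound, component \<open>j\<close> does not drop below
      \<open>m $ i\<close>.\<close>
    show "0 \<le> (m + e *\<^sub>R (axis i 1 - axis j 1)) $ k" if "0 < e" "e \<le> m $ j - m $ i" for e k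
      using polymatroidD(1)[OF m, of k] polymatroidD(1)[OF m, of i] that by (auto simp: axis_def)
  qed (use j in \<open>auto simp: sum_subtractf sum_axis\<close>)
  then show ?thesis using that j(2) by blast
qed

section \<open>Characterization, existence and uniqueness of the fair point\<close>

lemma max_min_fair_iff_tightly_topped:
  assumes "submodular g"
  shows "max_min_fair (polymatroid g) m \<longleftrightarrow> m \<in> polymatroid g \<and> (\<forall>i. tightly_topped g m i)"
proof (intro iffI conjI allI)
  assume fair: "max_min_fair (polymatroid g) m"
  then show m: "m \<in> polymatroid g" by (simp add: max_min_fair_def)
  fix i
  show "tightly_topped g m i"
  proof (rule ccontr)
    assume "\<not> tightly_topped g m i"
    then obtain v d where d: "0 < d" "\<And>e. 0 < e \<Longrightarrow> e \<le> d \<Longrightarrow> m + e *\<^sub>R v \<in> polymatroid g"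
      and v: "v = axis i 1 \<or> (\<exists>j. m $ i < m $ j \<and> v = axis i 1 - axis j 1)"
      using improving_exchange[OF assms m] by metis
    have "(m + d *\<^sub>R v) $ i > m $ i" using v d(1) by (auto simp: axis_def)
    then obtain k where "(m + d *\<^sub>R v) $ k < m $ k" "m $ k \<le> m $ i"
      using fair d unfolding max_min_fair_def by blast
    \<comment> \<open>Only \<open>j\<close> can decrease, and \<open>m $ j > m $ i\<close>.\<close>
    then show False using v d(1) by (auto simp: axis_def split: if_splits)
  qed
next
  assume *: "m \<in> polymatroid g \<and> (\<forall>i. tightly_topped g m i)"
  have "\<exists>j. r $ j < m $ j \<and> m $ j \<le> m $ i" if r: "r \<in> polymatroid g" "m $ i < r $ i" for r i
  proof (rule ccontr)
    assume no: "\<not> (\<exists>j. r $ j < m $ j \<and> m $ j \<le> m $ i)"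
    obtain S where S: "tight g m S" "i \<in> S" "\<forall>j\<in>S. m $ j \<le> m $ i"
      using * unfolding tightly_topped_def by blast
    \<comment> \<open>On \<open>S\<close> no component of \<open>r\<close> falls below that of
      \<open>m\<close>, and \<open>i\<close> rises strictly.\<close>
    then have "(\<Sum>j\<in>S. m $ j) < (\<Sum>j\<in>S. r $ j)"
      using no r(2) by (intro sum_strict_mono_ex1) (auto simp: not_less)
    then show False using S(1) polymatroidD(2)[OF r(1), of S] by (simp add: tight_def)
  qed
  then show "max_min_fair (polymatroid g) m" using * by (auto simp: max_min_fair_def)
qed

lemma closed_polymatroid: "closed (polymatroid g)"
  unfolding polymatroid_def
  by (intro closed_Collect_conj closed_Collect_all closed_Collect_le continuous_intros)

lemma max_min_fair_exists:
  fixes g :: "'n::finite set \<Rightarrow> real"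
  assumes nonneg: "\<And>S. 0 \<le> g S" and "submodular g"
  shows "\<exists>m. max_min_fair (polymatroid g) m"
proof -
  \<comment> \<open>\<open>C\<close> exceeds every component of every feasible point, as each is at
    most \<open>g {i}\<close>.\<close>
  define C where "C = 1 + (\<Sum>i\<in>UNIV. g {i})"
  define a :: "real ^ 'n" where "a = (\<chi> i. C)"
  have "0 \<in> polymatroid g" using nonneg by (simp add: polymatroid_def)
  then obtain m where m: "m \<in> polymatroid g" and min: "\<And>r. r \<in> polymatroid g \<Longrightarrow> dist a m \<le> dist a r"
    using distance_attains_inf[OF closed_polymatroid, of g a] by auto
  have "tightly_topped g m i" for i
  proof (rule ccontr)
    assume "\<not> tightly_topped g m i"
    then obtain v d where d: "0 < d" "\<And>e. 0 < e \<Longrightarrow> e \<le> d \<Longrightarrow> m + e *\<^sub>R v \<in> polymatroid g"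
      and v: "v = axis i 1 \<or> (\<exists>j. m $ i < m $ j \<and> v = axis i 1 - axis j 1)"
      using improving_exchange[OF assms(2) m] by metis
    have "m $ i \<le> g {i}" using polymatroidD(2)[OF m, of "{i}"] by simp
    also have "\<dots> \<le> (\<Sum>i\<in>UNIV. g {i})" by (rule member_le_sum) (auto simp: nonneg)
    finally have "m $ i < C" by (simp add: C_def)
    \<comment> \<open>The product is \<open>C - m $ i\<close> for a raise and
      \<open>m $ j - m $ i\<close> for a transfer; either way \<open>v\<close> leads closer to
      \<open>a\<close>.\<close>
    then have "(a - m) \<bullet> v > 0"
      using v by (auto simp: inner_diff_right inner_axis a_def)
    then obtain u where u: "u > 0" "\<And>e. 0 < e \<Longrightarrow> e \<le> u \<Longrightarrow> norm (e *\<^sub>R v - (a - m)) < norm (a - m)"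
      using closer_points_lemma by blast
    define e where "e = min u d"
    have "0 < e" "e \<le> u" "e \<le> d" using u d by (auto simp: e_def)
    then have "dist a (m + e *\<^sub>R v) < dist a m"
      using u(2)[of e] by (simp add: dist_norm norm_minus_commute algebra_simps)
    with min[OF d(2)[of e]] \<open>0 < e\<close> \<open>e \<le> d\<close> show False by simp
  qed
  then show ?thesis using m max_min_fair_iff_tightly_topped[OF assms(2)] by blast
qed

text \<open>Among the coordinates where the points differ, take one whose smaller value is least.
  Fairness of the point attaining that value yields a differing coordinate with a still smaller
  value.\<close>

lemma max_min_fair_unique:
  fixes R :: "(real ^ 'n::finite) set"
  assumes "max_min_fair R m" "max_min_fair R r"
  shows "m = r"
proof (rule ccontr)
  assume "m \<noteq> r"
  define D where "D = {i. m $ i \<noteq> r $ i}"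
  have "finite D" "D \<noteq> {}" using \<open>m \<noteq> r\<close> by (auto simp: D_def vec_eq_iff)
  then obtain i where i: "i \<in> D" "\<And>j. j \<in> D \<Longrightarrow> min (m $ i) (r $ i) \<le> min (m $ j) (r $ j)"
    using ex_min_if_finite[of "(\<lambda>i. min (m $ i) (r $ i)) ` D"] by (force simp: not_less)
  have "\<exists>j. j \<in> D \<and> min (m $ j) (r $ j) < min (m $ i) (r $ i)"
  proof (cases "m $ i < r $ i")
    case True
    then obtain j where "r $ j < m $ j" "m $ j \<le> m $ i"
      using assms unfolding max_min_fair_def by blast
    then show ?thesis using True by (intro exI[of _ j]) (auto simp: D_def)
  next
    case False
    then have less: "r $ i < m $ i" using i(1) by (auto simp: D_def)
    then obtain j where "m $ j < r $ j" "r $ j \<le> r $ i"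
      using assms unfolding max_min_fair_def by blast
    then show ?thesis using less by (intro exI[of _ j]) (auto simp: D_def)
  qed
  then show False using i(2) by (meson not_le)
qed

section \<open>Level sets and shortfalls\<close>

lemma tight_lower_level_set:
  assumes "submodular g" "m \<in> polymatroid g" "\<And>i. tightly_topped g m i" "m $ i \<le> s"
  shows "tight g m {i. m $ i \<le> s}"
proof -
  obtain S where S: "\<And>i. tight g m (S i)" "\<And>i. i \<in> S i" "\<And>i j. j \<in> S i \<Longrightarrow> m $ j \<le> m $ i"
    using assms(3) unfolding tightly_topped_def by metis
  \<comment> \<open>A bottleneck of \<open>i\<close> stays within any lower level set containing
    \<open>i\<close>.\<close>
  have "{i. m $ i \<le> s} = \<Union>(S ` {i. m $ i \<le> s})"
    using S(2,3) by (force intro: order_trans)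
  moreover have "tight g m (\<Union>(S ` {i. m $ i \<le> s}))"
    using assms(4) S(1) by (intro tight_Union[OF assms(1,2)]) auto
  ultimately show ?thesis by simp
qed

lemma max_min_fair_shortfall_le:
  assumes "submodular g" "max_min_fair (polymatroid g) m" "r \<in> polymatroid g"
  shows "(\<Sum>i\<in>UNIV. max 0 (s - m $ i)) \<le> (\<Sum>i\<in>UNIV. max 0 (s - r $ i))"
proof -
  define U where "U = {i. m $ i \<le> s}"
  have m: "m \<in> polymatroid g" "\<And>i. tightly_topped g m i"
    using assms max_min_fair_iff_tightly_topped by auto
  have "(\<Sum>i\<in>U. r $ i) \<le> (\<Sum>i\<in>U. m $ i)"
  \<comment> \<open>The empty set need not be tight, since \<open>g {}\<close> may be
    positive.\<close>
  proof (cases "U = {}")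
    case False
    then have "tight g m U"
      using tight_lower_level_set[OF assms(1) m] by (auto simp: U_def)
    then show ?thesis using polymatroidD(2)[OF assms(3), of U] by (simp add: tight_def)
  qed simp
  have "(\<Sum>i\<in>UNIV. max 0 (s - m $ i)) = (\<Sum>i\<in>U. max 0 (s - m $ i))"
    by (rule sum.mono_neutral_right) (auto simp: U_def)
  also have "\<dots> = (\<Sum>i\<in>U. s - m $ i)"
    by (rule sum.cong) (auto simp: U_def)
  also have "\<dots> \<le> (\<Sum>i\<in>U. s - r $ i)"
    using \<open>(\<Sum>i\<in>U. r $ i) \<le> (\<Sum>i\<in>U. m $ i)\<close> by (simp add: sum_subtractf)
  also have "\<dots> \<le> (\<Sum>i\<in>U. max 0 (s - r $ i))" by (rule sum_mono) simp
  also have "\<dots> \<le> (\<Sum>i\<in>UNIV. max 0 (s - r $ i))" by (rule sum_mono2) auto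
  finally show ?thesis .
qed

section \<open>Duality between order statistics and shortfalls\<close>

lemma sum_order_stat:
  fixes x :: "real ^ 'n::finite" and f :: "real \<Rightarrow> real"
  shows "(\<Sum>i=1..CARD('n). f (order_stat x i)) = (\<Sum>i\<in>UNIV. f (x $ i))"
proof -
  define xs where "xs = sorted_list_of_multiset (image_mset (\<lambda>i. x $ i) (mset_set UNIV))"
  have mset: "mset xs = image_mset (\<lambda>i. x $ i) (mset_set UNIV)" by (simp add: xs_def)
  then have len: "length xs = CARD('n)"
    by (metis size_mset size_image_mset size_mset_set)
  have "(\<Sum>i=1..CARD('n). f (order_stat x i)) = (\<Sum>i<length xs. f (xs ! i))"
    unfolding len by (rule sum.reindex_bij_witness[of _ Suc "\<lambda>i. i - 1"]) (auto simp: order_stat_def xs_def)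
  also have "\<dots> = sum_mset (image_mset f (mset xs))"
    by (simp add: sum_list_sum_nth atLeast0LessThan sum_mset_sum_list flip: mset_map)
  also have "\<dots> = (\<Sum>i\<in>UNIV. f (x $ i))"
    unfolding mset by (simp add: sum_unfold_sum_mset image_mset.compositionality comp_def)
  finally show ?thesis .
qed

lemma order_stat_mono:
  fixes x :: "real ^ 'n::finite"
  assumes "1 \<le> i" "i \<le> j" "j \<le> CARD('n)"
  shows "order_stat x i \<le> order_stat x j"
proof -
  have "length (sorted_list_of_multiset (image_mset (\<lambda>i. x $ i) (mset_set UNIV))) = CARD('n)"
    by (metis size_mset size_image_mset size_mset_set mset_sorted_list_of_multiset)
  then show ?thesis using assms unfolding order_stat_def
    by (intro sorted_nth_mono) auto
qed

text \<open>Truncating the gaps \<open>s - order_stat x i\<close> at 0 and summing over all indices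
  can only increase their sum.\<close>

lemma sum_smallest_ge:
  fixes x :: "real ^ 'n::finite"
  assumes "k \<le> CARD('n)"
  shows "real k * s - (\<Sum>i\<in>UNIV. max 0 (s - x $ i)) \<le> (\<Sum>i=1..k. order_stat x i)"
proof -
  have "real k * s - (\<Sum>i=1..k. order_stat x i) = (\<Sum>i=1..k. s - order_stat x i)"
    by (simp add: sum_subtractf)
  also have "\<dots> \<le> (\<Sum>i=1..k. max 0 (s - order_stat x i))" by (rule sum_mono) simp
  also have "\<dots> \<le> (\<Sum>i=1..CARD('n). max 0 (s - order_stat x i))"
    using assms by (intro sum_mono2) auto
  also have "\<dots> = (\<Sum>i\<in>UNIV. max 0 (s - x $ i))" by (rule sum_order_stat)
  finally show ?thesis by simp
qed

text \<open>For this \<open>s\<close> the bound \<open>sum_smallest_ge\<close> is attained: gaps are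
  nonnegative up to index \<open>k\<close> and nonpositive after it.\<close>

lemma sum_smallest_eq:
  fixes x :: "real ^ 'n::finite"
  assumes "1 \<le> k" "k \<le> CARD('n)"
  defines "s \<equiv> order_stat x k"
  shows "(\<Sum>i=1..k. order_stat x i) = real k * s - (\<Sum>i\<in>UNIV. max 0 (s - x $ i))"
proof -
  have "(\<Sum>i\<in>UNIV. max 0 (s - x $ i)) = (\<Sum>i=1..CARD('n). max 0 (s - order_stat x i))"
    by (rule sum_order_stat[symmetric])
  also have "\<dots> = (\<Sum>i=1..k. max 0 (s - order_stat x i))"
    using assms order_stat_mono[of k _ x] by (intro sum.mono_neutral_right) (auto simp: not_le)
  also have "\<dots> = (\<Sum>i=1..k. s - order_stat x i)"
    using assms order_stat_mono[of _ k x] by (intro sum.cong) auto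
  finally show ?thesis by (simp add: sum_subtractf)
qed

section \<open>Dominant face and majorization\<close>

lemma max_min_fair_in_dominant_face:
  fixes g :: "'n::finite set \<Rightarrow> real"
  assumes "submodular g" "max_min_fair (polymatroid g) m"
  shows "m \<in> dominant_face g"
proof -
  have m: "m \<in> polymatroid g" "\<And>i. tightly_topped g m i"
    using assms max_min_fair_iff_tightly_topped by auto
  \<comment> \<open>At the largest component the lower level set is \<open>UNIV\<close>.\<close>
  have le: "m $ i \<le> Max (range (($) m))" for i by simp
  then have "tight g m UNIV"
    using tight_lower_level_set[OF assms(1) m le] by simp
  then show ?thesis using m by (simp add: dominant_face_def tight_def)
qed

theorem theorem10:
  fixes g :: "'n::finite set \<Rightarrow> real"
  assumes nonneg: "\<And>S. 0 \<le> g S"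
    and submod: "submodular g"
  shows "(\<exists>!m. max_min_fair (polymatroid g) m) \<and>
    (\<forall>m. max_min_fair (polymatroid g) m \<longrightarrow>
       m \<in> dominant_face g \<and> (\<forall>r\<in>dominant_face g. m \<preceq>\<^sub>m r))"
proof (intro conjI allI impI ballI)
  show "\<exists>!m. max_min_fair (polymatroid g) m"
    using max_min_fair_exists[OF assms] max_min_fair_unique by blast
next
  fix m assume fair: "max_min_fair (polymatroid g) m"
  then show face: "m \<in> dominant_face g" by (rule max_min_fair_in_dominant_face[OF submod])
  fix r assume r: "r \<in> dominant_face g"
  then have rP: "r \<in> polymatroid g" by (simp add: dominant_face_def)
  have "(\<Sum>i=1..k. order_stat r i) \<le> (\<Sum>i=1..k. order_stat m i)" if k: "k \<in> {1..CARD('n) - 1}" for k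
  proof -
    have k': "1 \<le> k" "k \<le> CARD('n)" using k by auto
    show ?thesis
      \<comment> \<open>The level is chosen from \<open>r\<close>: equality is needed for
        \<open>r\<close>, while the bound for \<open>m\<close> holds at any level.\<close>
      using sum_smallest_eq[OF k', of r] sum_smallest_ge[OF k'(2), of "order_stat r k" m]
        max_min_fair_shortfall_le[OF submod fair rP, of "order_stat r k"] by linarith
  qed
  moreover have "(\<Sum>i=1..CARD('n). order_stat m i) = (\<Sum>i=1..CARD('n). order_stat r i)"
    using face r sum_order_stat[of "\<lambda>t. t" m] sum_order_stat[of "\<lambda>t. t" r]
    by (simp add: dominant_face_def)
  ultimately show "m \<preceq>\<^sub>m r" by (simp add: majorized_by_def)
qed

end
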